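(* For all $x,y\in\mathbb R^n$ with $x\neq y$, the sequence of sets $\{\mathcal D^{(p)}(x,y)\}_{p\in\mathbb N}$ converges in the Kuratowski–Painlevé sense and $$\mathop{\mathrm{Lim}}_{p\to\infty}\mathcal D^{(p)}(x,y)=\mathcal D^\infty(x,y).$$
   Context: For $p\in\mathbb N$ and $\lambda,\mu\in\mathbb R$ let $\lambda\stackrel{p}{+}\mu=(\lambda^{2p+1}+\mu^{2p+1})^{1/(2p+1)}$ (real odd roots), applied coordinatewise to vectors of $\mathbb R^n$. The $\varphi_p$-line through $x$ and $y$ is $\mathcal D^{(p)}(x,y)=\{tx\stackrel{p}{+}sy:\ s\stackrel{p}{+}t=1,\ s,t\in\mathbb R\}$. For $u\in\mathbb R^m$, the $m$-ary operation $u_1\boxplus\cdots\boxplus u_m$ (which is not an iteration of a binary operation) is $\lim_{p\to\infty}\big(\sum_{i=1}^m u_i^{2p+1}\big)^{1/(2p+1)}$. Explicitly: discard every index $i$ with $\mathrm{Card}\{j:u_j=u_i\}=\mathrm{Card}\{j:u_j=-u_i\}$; if no index remains the value is $0$; otherwise let $M$ be the maximum of $|u_i|$ over the remaining indices; the value is $M$ if $\mathrm{Card}\{j:u_j=M\}>\mathrm{Card}\{j:u_j=-M\}$ and $-M$ otherwise. For vectors the operation is applied coordinatewise. Define $$\mathcal D^\infty(x,y)=\{tx\boxplus rx\boxplus sy\boxplus wy:\ t\boxplus r\boxplus s\boxplus w=1,\ t,r,s,w\in\mathbb R\},$$ where both expressions are the $4$-ary operation. Kuratowski–Painlevé limits: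 for a sequence $\{A_p\}$ of subsets of $\mathbb R^n$, $\mathrm{Li}_{p\to\infty}A_p$ is the set of limits of sequences $(x^{(p)})$ with $x^{(p)}\in A_p$ for all $p$; $\mathrm{Ls}_{p\to\infty}A_p$ is the set of limits of sequences $(x^{(p_k)})_k$ with $(p_k)$ increasing and $x^{(p_k)}\in A_{p_k}$ for all $k$. The sequence converges to $A$, written $A=\mathrm{Lim}_{p\to\infty}A_p$, if $\mathrm{Ls}_{p\to\infty}A_p=A=\mathrm{Li}_{p\to\infty}A_p$. *)

theory Defs
  imports "HOL-Analysis.Analysis"
begin

text \<open>In Isabelle/HOL \<open>root\<close> extends to negative arguments as an odd function, so
  \<open>root (2 * p + 1)\<close> is the real odd root.\<close>

definition phi_add :: "nat \<Rightarrow> real \<Rightarrow> real \<Rightarrow> real" where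
  "phi_add p a b = root (2 * p + 1) (a ^ (2 * p + 1) + b ^ (2 * p + 1))"

definition phi_add_vec :: "nat \<Rightarrow> real ^ 'n \<Rightarrow> real ^ 'n \<Rightarrow> real ^ 'n" where
  "phi_add_vec p x y = (\<chi> i. phi_add p (x $ i) (y $ i))"

definition phi_line :: "nat \<Rightarrow> real ^ 'n \<Rightarrow> real ^ 'n \<Rightarrow> (real ^ 'n) set" where
  "phi_line p x y = {phi_add_vec p (t *\<^sub>R x) (s *\<^sub>R y) | s t. phi_add p s t = 1}"

text \<open>The operation is \<open>m\<close>-ary and not an iterated binary one, so it takes the list of all
  its arguments. The limit always exists; \<open>boxplus_tendsto\<close> and \<open>boxplus_explicit\<close> below
  give convergence and the closed form \<open>boxplus_value\<close>.\<close>

definition boxplus :: "real list \<Rightarrow> real" where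
  "boxplus us = lim (\<lambda>p. root (2 * p + 1) (\<Sum>u\<leftarrow>us. u ^ (2 * p + 1)))"

definition boxplus_vec :: "(real ^ 'n) list \<Rightarrow> real ^ 'n" where
  "boxplus_vec xs = (\<chi> i. boxplus (map (\<lambda>x. x $ i) xs))"

definition line_infty :: "real ^ 'n \<Rightarrow> real ^ 'n \<Rightarrow> (real ^ 'n) set" where
  "line_infty x y =
     {boxplus_vec [t *\<^sub>R x, r *\<^sub>R x, s *\<^sub>R y, w *\<^sub>R y] | t r s w. boxplus [t, r, s, w] = 1}"

definition PK_Li :: "(nat \<Rightarrow> 'a::topological_space set) \<Rightarrow> 'a set" where
  "PK_Li A = {l. \<exists>X. (\<forall>p. X p \<in> A p) \<and> X \<longlonglongrightarrow> l}"

definition PK_Ls :: "(nat \<Rightarrow> 'a::topological_space set) \<Rightarrow> 'a set" where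
  "PK_Ls A = {l. \<exists>\<sigma> X. strict_mono \<sigma> \<and> (\<forall>k. X k \<in> A (\<sigma> k)) \<and> X \<longlonglongrightarrow> l}"

definition PK_converges_to :: "(nat \<Rightarrow> 'a::topological_space set) \<Rightarrow> 'a set \<Rightarrow> bool" where
  "PK_converges_to A L \<longleftrightarrow> PK_Ls A = L \<and> PK_Li A = L"

definition boxplus_value :: "real list \<Rightarrow> real" where
  "boxplus_value us =
     (let R = {u \<in> set us. count_list us u \<noteq> count_list us (- u)};
          M = Max (abs ` R)
      in if R = {} then 0
         else if count_list us M > count_list us (- M) then M else - M)"

lemma sum_list_odd_power:
  fixes us :: "real list"
  assumes "finite A" "\<And>a. a \<in> A \<Longrightarrow> a > 0" "\<And>u. u \<in> set us \<Longrightarrow> u \<noteq> 0 \<Longrightarrow> \<bar>u\<bar> \<in> A"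
  shows "(\<Sum>u\<leftarrow>us. u ^ (2 * p + 1)) =
    (\<Sum>a\<in>A. (real (count_list us a) - real (count_list us (- a))) * a ^ (2 * p + 1))"
  using assms(3)
proof (induction us)
  case Nil
  then show ?case by simp
next
  case (Cons u us)
  let ?d = "\<lambda>a. (real (count_list us a) - real (count_list us (- a))) * a ^ (2 * p + 1)"
  let ?e = "\<lambda>a. (if a = \<bar>u\<bar> then u ^ (2 * p + 1) else 0)"
  have "(\<Sum>a\<in>A. (real (count_list (u # us) a) - real (count_list (u # us) (- a))) * a ^ (2 * p + 1))
      = (\<Sum>a\<in>A. ?d a + ?e a)"
  proof (rule sum.cong[OF refl])
    fix a assume "a \<in> A"
    then have "a > 0" using assms(2) by blast
    then show "(real (count_list (u # us) a) - real (count_list (u # us) (- a))) * a ^ (2 * p + 1)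
      = ?d a + ?e a"
      by (auto simp: algebra_simps abs_if)
  qed
  also have "\<dots> = sum ?d A + (if \<bar>u\<bar> \<in> A then u ^ (2 * p + 1) else 0)"
    using assms(1) by (simp add: sum.distrib)
  also have "\<dots> = sum ?d A + u ^ (2 * p + 1)"
    using Cons.prems[of u] by auto
  finally show ?case using Cons by simp
qed

lemma root_odd_tendsto_sgn:
  fixes f :: "nat \<Rightarrow> real"
  assumes f: "f \<longlonglongrightarrow> d" and d: "d \<noteq> 0"
  shows "(\<lambda>p. root (2 * p + 1) (f p)) \<longlonglongrightarrow> sgn d"
proof -
  have "(\<lambda>p. ln \<bar>f p\<bar> / real (2 * p + 1)) \<longlonglongrightarrow> 0"
  proof (rule real_tendsto_divide_at_top)
    show "(\<lambda>p. ln \<bar>f p\<bar>) \<longlonglongrightarrow> ln \<bar>d\<bar>" using f d by (intro tendsto_intros) auto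
    show "filterlim (\<lambda>p. real (2 * p + 1)) at_top sequentially"
      by (rule filterlim_compose[OF filterlim_real_sequentially])
        (rule filterlim_subseq, simp add: strict_mono_def)
  qed
  then have e: "(\<lambda>p. exp (ln \<bar>f p\<bar> / real (2 * p + 1))) \<longlonglongrightarrow> exp 0" by (intro tendsto_intros)
  then have "(\<lambda>p. sgn (f p) * exp (ln \<bar>f p\<bar> / real (2 * p + 1))) \<longlonglongrightarrow> sgn d * exp 0"
    by (intro tendsto_mult e tendsto_sgn f d)
  moreover have "\<forall>\<^sub>F p in sequentially. sgn (f p) * exp (ln \<bar>f p\<bar> / real (2 * p + 1)) = root (2 * p + 1) (f p)"
    using tendsto_imp_eventually_ne[OF f d]
  proof eventually_elim
    case (elim p)
    have "root (2 * p + 1) (f p) = sgn (f p) * root (2 * p + 1) \<bar>f p\<bar>"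
      by (cases "f p > 0") (use elim in \<open>auto simp: sgn_if abs_if real_root_minus\<close>)
    also have "root (2 * p + 1) \<bar>f p\<bar> = exp (ln \<bar>f p\<bar> / real (2 * p + 1))"
      using elim by (subst root_powr_inverse) (auto simp: powr_def)
    finally show ?case by simp
  qed
  ultimately have "(\<lambda>p. root (2 * p + 1) (f p)) \<longlonglongrightarrow> sgn d * exp 0"
    by (rule Lim_transform_eventually)
  then show ?thesis by simp
qed

lemma tendsto_boxplus_value:
  "(\<lambda>p. root (2 * p + 1) (\<Sum>u\<leftarrow>us. u ^ (2 * p + 1))) \<longlonglongrightarrow> boxplus_value us"
proof -
  define R where "R = {u \<in> set us. count_list us u \<noteq> count_list us (- u)}"
  define d where "d = (\<lambda>a. real (count_list us a) - real (count_list us (- a)))"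
  define A where "A = abs ` set us - {0}"
  have sum: "(\<Sum>u\<leftarrow>us. u ^ (2 * p + 1)) = (\<Sum>a\<in>A. d a * a ^ (2 * p + 1))" for p
    unfolding d_def by (rule sum_list_odd_power) (auto simp: A_def)
  have dR: "d a \<noteq> 0 \<longleftrightarrow> a \<in> abs ` R" if "a \<in> A" for a
  proof
    assume "d a \<noteq> 0"
    then have "a \<in> R \<or> - a \<in> R"
      unfolding d_def R_def using count_list_0_iff[of us a] count_list_0_iff[of us "- a"] by force
    then moreover have "a = \<bar>a\<bar>" "a = \<bar>- a\<bar>" using that by (auto simp: A_def)
    ultimately show "a \<in> abs ` R" by (metis image_eqI)
  next
    assume "a \<in> abs ` R"
    then show "d a \<noteq> 0" by (auto simp: R_def d_def abs_if split: if_splits)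
  qed
  show ?thesis
  proof (cases "R = {}")
    case True
    then have "d a = 0" if "a \<in> A" for a using dR[OF that] by simp
    then have "(\<Sum>u\<leftarrow>us. u ^ (2 * p + 1)) = 0" for p unfolding sum by simp
    moreover have "boxplus_value us = 0"
      using True by (simp add: boxplus_value_def R_def)
    ultimately show ?thesis by simp
  next
    case False
    define M where "M = Max (abs ` R)"
    have finR: "finite R" by (simp add: R_def)
    have MR: "M \<in> abs ` R" unfolding M_def using finR False by (intro Max_in) auto
    have nz: "0 \<notin> R" by (simp add: R_def)
    have M0: "M > 0" using MR nz by auto
    have MA: "M \<in> A" using MR M0 by (auto simp: A_def R_def)
    have dM: "d M \<noteq> 0" using dR[OF MA] MR by simp
    have lim: "(\<lambda>p. \<Sum>a\<in>A. d a * (a / M) ^ (2 * p + 1)) \<longlonglongrightarrow> (\<Sum>a\<in>A. if a = M then d M else 0)"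
    proof (rule tendsto_sum)
      fix a assume a: "a \<in> A"
      then have a0: "a > 0" by (auto simp: A_def)
      show "(\<lambda>p. d a * (a / M) ^ (2 * p + 1)) \<longlonglongrightarrow> (if a = M then d M else 0)"
      proof (cases "a = M")
        case True
        then show ?thesis using M0 by simp
      next
        case ne: False
        show ?thesis
        proof (cases "a \<in> abs ` R")
          case True
          then have "a \<le> M" unfolding M_def using finR by simp
          then have lt: "a / M < 1" using ne M0 by simp
          have "(\<lambda>n. (a / M) ^ n) \<longlonglongrightarrow> 0"
            using lt a0 M0 by (intro LIMSEQ_realpow_zero) auto
          then have "((\<lambda>n. (a / M) ^ n) \<circ> (\<lambda>p. 2 * p + 1)) \<longlonglongrightarrow> 0"
            by (rule LIMSEQ_subseq_LIMSEQ) (simp add: strict_mono_def)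
          then have "(\<lambda>p. d a * (a / M) ^ (2 * p + 1)) \<longlonglongrightarrow> d a * 0"
            by (intro tendsto_intros) (simp add: o_def)
          then show ?thesis using ne by simp
        next
          case False
          then have "d a = 0" using dR[OF a] by simp
          then show ?thesis using ne by simp
        qed
      qed
    qed
    have "finite A" by (simp add: A_def)
    then have "(\<lambda>p. \<Sum>a\<in>A. d a * (a / M) ^ (2 * p + 1)) \<longlonglongrightarrow> d M"
      using lim MA by simp
    from tendsto_mult[OF tendsto_const[of M] root_odd_tendsto_sgn[OF this dM]]
    have "(\<lambda>p. M * root (2 * p + 1) (\<Sum>a\<in>A. d a * (a / M) ^ (2 * p + 1))) \<longlonglongrightarrow> M * sgn (d M)" .
    moreover have "M * root (2 * p + 1) (\<Sum>a\<in>A. d a * (a / M) ^ (2 * p + 1))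
        = root (2 * p + 1) (\<Sum>u\<leftarrow>us. u ^ (2 * p + 1))" for p
    proof -
      have "(\<Sum>u\<leftarrow>us. u ^ (2 * p + 1)) = M ^ (2 * p + 1) * (\<Sum>a\<in>A. d a * (a / M) ^ (2 * p + 1))"
        unfolding sum sum_distrib_left using M0 by (intro sum.cong) (auto simp: power_divide)
      then show ?thesis
        using M0 by (simp only: real_root_mult) (simp add: real_root_power_cancel del: power_Suc)
    qed
    moreover have "M * sgn (d M) = boxplus_value us"
      using False dM by (auto simp: boxplus_value_def Let_def d_def sgn_if
          R_def[symmetric] M_def[symmetric])
    ultimately show ?thesis by simp
  qed
qed

lemma boxplus_explicit: "boxplus us = boxplus_value us"
  unfolding boxplus_def by (rule limI) (rule tendsto_boxplus_value)

lemma boxplus_tendsto: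
  "(\<lambda>p. root (2 * p + 1) (\<Sum>u\<leftarrow>us. u ^ (2 * p + 1))) \<longlonglongrightarrow> boxplus us"
  unfolding boxplus_explicit by (rule tendsto_boxplus_value)

end

theory Submission
  imports Defs
begin

text \<open>A point of the limit line is reached by merging its four coefficients into two with the
  \<open>p\<close>-sum and dividing by their total \<open>p\<close>-sum, which tends to 1.

  Conversely, along a convergent sequence of points the coefficients \<open>t\<close> and \<open>s\<close> are bounded
  because \<open>x\<close> and \<open>y\<close> differ in some coordinate, so on a subsequence they tend to some \<open>\<tau>\<close> and
  \<open>\<sigma>\<close>. The \<open>p\<close>-sum of \<open>t * a\<close> and \<open>s * b\<close> then tends to the dominant one of \<open>\<tau> * a\<close> and
  \<open>\<sigma> * b\<close> unless these cancel. In that case it equals \<open>a\<close> times the \<open>p\<close>-sum of \<open>t\<close> and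
  \<open>- (\<tau> / \<sigma>) * s\<close>, which does not depend on the coordinate, so all cancelling coordinates share
  one residue \<open>\<rho>\<close> with \<open>\<bar>\<rho>\<bar> \<le> \<bar>\<tau>\<bar>\<close>. The two additional coefficients of the limit line absorb
  this residue. The normalisation is the same statement for a coordinate with \<open>a = b = 1\<close>.\<close>

section \<open>Algebra and bounds for the \<open>p\<close>-sum at fixed \<open>p\<close>\<close>

lemma phi_add_power: "phi_add p a b ^ (2 * p + 1) = a ^ (2 * p + 1) + b ^ (2 * p + 1)"
  unfolding phi_add_def by (rule odd_real_root_pow) simp

lemma odd_root_power: "root (2 * p + 1) (a ^ (2 * p + 1)) = a"
  by (rule odd_real_root_power_cancel) simp

lemma phi_add_commute: "phi_add p a b = phi_add p b a"
  by (simp add: phi_add_def add.commute)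

lemma phi_add_scale: "phi_add p (c * a) (c * b) = c * phi_add p a b"
proof -
  have "phi_add p (c * a) (c * b) = root (2 * p + 1) (c ^ (2 * p + 1) * (a ^ (2 * p + 1) + b ^ (2 * p + 1)))"
    unfolding phi_add_def by (simp only: power_mult_distrib distrib_left)
  also have "\<dots> = c * phi_add p a b"
    unfolding phi_add_def by (simp only: real_root_mult odd_root_power)
  finally show ?thesis .
qed

lemma phi_add_minus: "phi_add p (- a) (- b) = - phi_add p a b"
  using phi_add_scale[of p "-1" a b] by simp

text \<open>The factor \<open>root (2 * p + 1) 2\<close> is kept because it tends to 1, so the bound
  becomes sharp in the limit.\<close>

lemma abs_phi_add_le: "\<bar>phi_add p a b\<bar> \<le> root (2 * p + 1) 2 * max \<bar>a\<bar> \<bar>b\<bar>"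
proof -
  let ?N = "2 * p + 1" and ?m = "max \<bar>a\<bar> \<bar>b\<bar>"
  have "\<bar>a ^ ?N + b ^ ?N\<bar> \<le> \<bar>a\<bar> ^ ?N + \<bar>b\<bar> ^ ?N"
    by (metis abs_triangle_ineq power_abs)
  also have "\<dots> \<le> ?m ^ ?N + ?m ^ ?N"
    by (intro add_mono power_mono) auto
  finally have "root ?N \<bar>a ^ ?N + b ^ ?N\<bar> \<le> root ?N (2 * ?m ^ ?N)"
    by (intro real_root_le_mono) auto
  also have "\<dots> = root ?N 2 * ?m"
    by (simp only: real_root_mult odd_root_power)
  finally show ?thesis
    unfolding phi_add_def by (simp add: real_root_abs)
qed

lemma abs_phi_add_le_2: "\<bar>phi_add p a b\<bar> \<le> 2 * max \<bar>a\<bar> \<bar>b\<bar>"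
proof -
  have "root (2 * p + 1) 2 \<le> root (2 * p + 1) (2 ^ (2 * p + 1))"
    by (intro real_root_le_mono) auto
  then have "root (2 * p + 1) 2 \<le> 2" by (simp only: odd_root_power)
  then have "root (2 * p + 1) 2 * max \<bar>a\<bar> \<bar>b\<bar> \<le> 2 * max \<bar>a\<bar> \<bar>b\<bar>"
    by (rule mult_right_mono) auto
  with abs_phi_add_le[of p a b] show ?thesis by linarith
qed

section \<open>Limits of \<open>p\<close>-sums with convergent arguments\<close>

lemma tendsto_root_odd_const:
  fixes p :: "nat \<Rightarrow> nat"
  assumes "filterlim p at_top sequentially" "c > 0"
  shows "(\<lambda>k. root (2 * p k + 1) c) \<longlonglongrightarrow> 1"
proof (rule filterlim_compose[OF LIMSEQ_root_const[OF assms(2)]])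
  show "filterlim (\<lambda>k. 2 * p k + 1) at_top sequentially"
    by (rule filterlim_at_top_mono[OF assms(1)]) simp
qed

text \<open>Cancelling limits are allowed here: the limit of the \<open>p\<close>-sum is then not
  determined by \<alpha> and \<beta>, but its size is still controlled. This will bound the residue
  \<rho>.\<close>

lemma phi_add_lim_abs_le:
  assumes "filterlim p at_top sequentially" "a \<longlonglongrightarrow> \<alpha>" "b \<longlonglongrightarrow> \<beta>"
    and "(\<lambda>k. phi_add (p k) (a k) (b k)) \<longlonglongrightarrow> l"
  shows "\<bar>l\<bar> \<le> max \<bar>\<alpha>\<bar> \<bar>\<beta>\<bar>"
proof (rule LIMSEQ_le)
  show "(\<lambda>k. \<bar>phi_add (p k) (a k) (b k)\<bar>) \<longlonglongrightarrow> \<bar>l\<bar>"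
    using assms(4) by (rule tendsto_rabs)
  have "(\<lambda>k. root (2 * p k + 1) 2 * max \<bar>a k\<bar> \<bar>b k\<bar>) \<longlonglongrightarrow> 1 * max \<bar>\<alpha>\<bar> \<bar>\<beta>\<bar>"
    by (intro tendsto_intros tendsto_root_odd_const assms) simp
  then show "(\<lambda>k. root (2 * p k + 1) 2 * max \<bar>a k\<bar> \<bar>b k\<bar>) \<longlonglongrightarrow> max \<bar>\<alpha>\<bar> \<bar>\<beta>\<bar>" by simp
qed (use abs_phi_add_le in blast)

lemma phi_add_tendsto_pos:
  assumes p: "filterlim p at_top sequentially" and a: "a \<longlonglongrightarrow> \<alpha>" and b: "b \<longlonglongrightarrow> \<beta>"
    and "\<alpha> > 0" "\<beta> \<le> \<alpha>" "- \<alpha> < \<beta>"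
  shows "(\<lambda>k. phi_add (p k) (a k) (b k)) \<longlonglongrightarrow> \<alpha>"
proof -
  \<comment> \<open>Any \<open>q\<close> strictly between 0 and 1 and above
    \<open>- \<beta> / \<alpha>\<close> would do. The second entry is the midpoint of 1 and
    \<open>- \<beta> / \<alpha>\<close>; the entry 1/2 keeps \<open>q\<close> positive.\<close>
  define q where "q = max (1/2) ((1 - \<beta> / \<alpha>) / 2)"
  have q: "0 < q" "q < 1" "- q * \<alpha> < \<beta>"
  proof -
    show "0 < q" by (simp add: q_def)
    have "- 1 < \<beta> / \<alpha>" using assms by (simp add: less_divide_eq)
    then show "q < 1" by (simp add: q_def)
    have "- (\<beta> / \<alpha>) < q" using \<open>- 1 < \<beta> / \<alpha>\<close> by (simp add: q_def less_max_iff_disj field_simps)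
    then show "- q * \<alpha> < \<beta>" using \<open>\<alpha> > 0\<close> by (simp add: field_simps)
  qed
  have "\<forall>\<^sub>F k in sequentially. - q * a k < b k"
  proof -
    have "(\<lambda>k. b k - (- q * a k)) \<longlonglongrightarrow> \<beta> - (- q * \<alpha>)" by (intro tendsto_intros a b)
    from order_tendstoD(1)[OF this, of 0] q(3) have "\<forall>\<^sub>F k in sequentially. 0 < b k - (- q * a k)"
      by simp
    then show ?thesis by eventually_elim simp
  qed
  moreover have "\<forall>\<^sub>F k in sequentially. 0 < a k"
    using order_tendstoD(1)[OF a \<open>\<alpha> > 0\<close>] .
  ultimately have lower: "\<forall>\<^sub>F k in sequentially.
      root (2 * p k + 1) (1 - q) * a k \<le> phi_add (p k) (a k) (b k)"
  proof eventually_elim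
    case (elim k)
    let ?N = "2 * p k + 1"
    have "(- q * a k) ^ ?N \<le> b k ^ ?N"
      using elim by (intro power_mono_odd) auto
    moreover have "(- q * a k) ^ ?N = - (q ^ ?N * a k ^ ?N)"
      by (simp add: power_mult_distrib)
    \<comment> \<open>Replacing \<open>q ^ ?N\<close> by \<open>q\<close> leaves the fixed fraction
      \<open>1 - q\<close> of the leading power, whose root tends to 1.\<close>
    moreover have "q ^ ?N * a k ^ ?N \<le> q * a k ^ ?N"
      using q elim power_decreasing[of 1 ?N q] by (intro mult_right_mono) auto
    ultimately have "(1 - q) * a k ^ ?N \<le> a k ^ ?N + b k ^ ?N"
      by (simp add: algebra_simps)
    then have "root ?N ((1 - q) * a k ^ ?N) \<le> phi_add (p k) (a k) (b k)"
      unfolding phi_add_def by (intro real_root_le_mono) auto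
    then show ?case by (simp only: real_root_mult odd_root_power)
  qed
  have upper: "\<forall>\<^sub>F k in sequentially.
      phi_add (p k) (a k) (b k) \<le> root (2 * p k + 1) 2 * max \<bar>a k\<bar> \<bar>b k\<bar>"
    using abs_phi_add_le by (intro always_eventually) (metis abs_le_iff)
  show ?thesis
  proof (rule tendsto_sandwich[OF lower upper])
    show "(\<lambda>k. root (2 * p k + 1) (1 - q) * a k) \<longlonglongrightarrow> \<alpha>"
      using tendsto_mult[OF tendsto_root_odd_const[OF p, of "1 - q"] a] q by simp
    have "(\<lambda>k. root (2 * p k + 1) 2 * max \<bar>a k\<bar> \<bar>b k\<bar>) \<longlonglongrightarrow> 1 * max \<bar>\<alpha>\<bar> \<bar>\<beta>\<bar>"
      by (intro tendsto_intros tendsto_root_odd_const a b p) simp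
    also have "1 * max \<bar>\<alpha>\<bar> \<bar>\<beta>\<bar> = \<alpha>" using assms by (auto simp: max_def)
    finally show "(\<lambda>k. root (2 * p k + 1) 2 * max \<bar>a k\<bar> \<bar>b k\<bar>) \<longlonglongrightarrow> \<alpha>" .
  qed
qed

lemma phi_add_tendsto_dominant:
  assumes p: "filterlim p at_top sequentially" and a: "a \<longlonglongrightarrow> \<alpha>" and b: "b \<longlonglongrightarrow> \<beta>"
    and "\<bar>\<beta>\<bar> \<le> \<bar>\<alpha>\<bar>" "\<alpha> = - \<beta> \<Longrightarrow> \<alpha> = 0"
  shows "(\<lambda>k. phi_add (p k) (a k) (b k)) \<longlonglongrightarrow> \<alpha>"
proof -
  consider "\<alpha> > 0" | "\<alpha> < 0" | "\<alpha> = 0" by linarith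
  then show ?thesis
  proof cases
    case 1
    then show ?thesis using assms by (intro phi_add_tendsto_pos[OF p a b]) linarith+
  next
    case 2
    have "(\<lambda>k. phi_add (p k) (- a k) (- b k)) \<longlonglongrightarrow> - \<alpha>"
      by (rule phi_add_tendsto_pos[OF p tendsto_minus[OF a] tendsto_minus[OF b]])
        (use 2 assms in linarith)+
    then have "(\<lambda>k. - phi_add (p k) (- a k) (- b k)) \<longlonglongrightarrow> - (- \<alpha>)"
      by (rule tendsto_minus)
    then show ?thesis by (simp add: phi_add_minus)
  next
    case 3
    then have "\<beta> = 0" using assms by simp
    have "(\<lambda>k. 2 * max \<bar>a k\<bar> \<bar>b k\<bar>) \<longlonglongrightarrow> 2 * max \<bar>\<alpha>\<bar> \<bar>\<beta>\<bar>"
      by (intro tendsto_intros a b)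
    then have "(\<lambda>k. 2 * max \<bar>a k\<bar> \<bar>b k\<bar>) \<longlonglongrightarrow> 0"
      using 3 \<open>\<beta> = 0\<close> by simp
    then have "(\<lambda>k. phi_add (p k) (a k) (b k)) \<longlonglongrightarrow> 0"
      by (rule Lim_null_comparison[rotated])
        (intro always_eventually allI, simp add: abs_phi_add_le_2)
    then show ?thesis using 3 by simp
  qed
qed

definition dominant :: "real \<Rightarrow> real \<Rightarrow> real" where
  "dominant a b = (if \<bar>b\<bar> \<le> \<bar>a\<bar> then a else b)"

lemma phi_add_tendsto:
  assumes p: "filterlim p at_top sequentially" and a: "a \<longlonglongrightarrow> \<alpha>" and b: "b \<longlonglongrightarrow> \<beta>"
    and "\<alpha> = - \<beta> \<Longrightarrow> \<alpha> = 0"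
  shows "(\<lambda>k. phi_add (p k) (a k) (b k)) \<longlonglongrightarrow> dominant \<alpha> \<beta>"
proof (cases "\<bar>\<beta>\<bar> \<le> \<bar>\<alpha>\<bar>")
  case True
  then show ?thesis
    using phi_add_tendsto_dominant[OF p a b True] assms(4) by (simp add: dominant_def)
next
  case False
  then have "(\<lambda>k. phi_add (p k) (b k) (a k)) \<longlonglongrightarrow> \<beta>"
    by (intro phi_add_tendsto_dominant[OF p b a]) auto
  then show ?thesis using False by (simp add: dominant_def phi_add_commute)
qed

section \<open>Absorbing a residue in the four-ary operation\<close>

lemma boxplus_eqI:
  assumes "(\<lambda>p. root (2 * p + 1) (\<Sum>u\<leftarrow>us. u ^ (2 * p + 1))) \<longlonglongrightarrow> l"
  shows "boxplus us = l"
  unfolding boxplus_def using assms by (rule limI)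

text \<open>Two of the four coefficients are \<open>\<tau>\<close> and \<open>\<sigma>\<close>; the other two supply, uniformly in \<open>a\<close> and
  \<open>b\<close>, what is left over when \<open>\<tau> * a\<close> and \<open>\<sigma> * b\<close> cancel. The choice \<open>r = \<rho>\<close>, \<open>w = 0\<close> works
  unless it cancels \<open>\<tau>\<close> itself, that is \<open>\<rho> = - \<tau>\<close>; then \<open>r = 0\<close>, \<open>w = \<sigma>\<close> does.\<close>

lemma boxplus_with_residue:
  assumes "\<bar>\<rho>\<bar> \<le> \<bar>\<tau>\<bar>"
  obtains r w where "\<And>a b. boxplus [\<tau> * a, r * a, \<sigma> * b, w * b] =
    (if \<tau> * a = - (\<sigma> * b) then \<rho> * a else dominant (\<tau> * a) (\<sigma> * b))"
proof (cases "\<rho> = - \<tau> \<and> \<tau> \<noteq> 0")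
  case False
  have "boxplus [\<tau> * a, \<rho> * a, \<sigma> * b, 0 * b] =
    (if \<tau> * a = - (\<sigma> * b) then \<rho> * a else dominant (\<tau> * a) (\<sigma> * b))" for a b
  proof (rule boxplus_eqI)
    let ?s = "\<lambda>p. root (2 * p + 1) (\<Sum>u\<leftarrow>[\<tau> * a, \<rho> * a, \<sigma> * b, 0 * b]. u ^ (2 * p + 1))"
    show "?s \<longlonglongrightarrow> (if \<tau> * a = - (\<sigma> * b) then \<rho> * a else dominant (\<tau> * a) (\<sigma> * b))"
    proof (cases "\<tau> * a = - (\<sigma> * b)")
      case True
      have "(\<Sum>u\<leftarrow>[\<tau> * a, \<rho> * a, \<sigma> * b, 0 * b]. u ^ (2 * p + 1)) = (\<rho> * a) ^ (2 * p + 1)" for p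
        unfolding list.map True by simp
      then have "?s = (\<lambda>p. \<rho> * a)" by (simp only: odd_root_power)
      then show ?thesis using True by simp
    next
      case ne: False
      \<comment> \<open>Nesting is exact at fixed \<open>p\<close>, although the limit operation is
        not an iterated binary one. The inner sum tends to \<open>\<tau> * a\<close>, so the outer
        one has no cancellation in the limit.\<close>
      have s: "?s p = phi_add p (phi_add p (\<tau> * a) (\<rho> * a)) (\<sigma> * b)" for p
        unfolding phi_add_def[of p "phi_add p (\<tau> * a) (\<rho> * a)"] phi_add_power by (simp add: add.assoc)
      have "\<bar>\<rho> * a\<bar> \<le> \<bar>\<tau> * a\<bar>"
        using assms by (simp add: abs_mult mult_right_mono)
      moreover have "\<tau> * a = 0" if "\<tau> * a = - (\<rho> * a)"
      proof -
        have "(\<tau> + \<rho>) * a = 0" using that by (simp add: algebra_simps)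
        then show ?thesis using False by (auto simp: add_eq_0_iff2)
      qed
      ultimately have "(\<lambda>p. phi_add p (\<tau> * a) (\<rho> * a)) \<longlonglongrightarrow> \<tau> * a"
        by (intro phi_add_tendsto_dominant) (auto intro: filterlim_ident)
      then have "(\<lambda>p. phi_add p (phi_add p (\<tau> * a) (\<rho> * a)) (\<sigma> * b)) \<longlonglongrightarrow> dominant (\<tau> * a) (\<sigma> * b)"
        using ne by (intro phi_add_tendsto) (auto intro: filterlim_ident)
      then show ?thesis using ne s by simp
    qed
  qed
  then show ?thesis by (rule that)
next
  case neg: True
  have "boxplus [\<tau> * a, 0 * a, \<sigma> * b, \<sigma> * b] =
    (if \<tau> * a = - (\<sigma> * b) then \<rho> * a else dominant (\<tau> * a) (\<sigma> * b))" for a b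
  proof (rule boxplus_eqI)
    let ?s = "\<lambda>p. root (2 * p + 1) (\<Sum>u\<leftarrow>[\<tau> * a, 0 * a, \<sigma> * b, \<sigma> * b]. u ^ (2 * p + 1))"
    show "?s \<longlonglongrightarrow> (if \<tau> * a = - (\<sigma> * b) then \<rho> * a else dominant (\<tau> * a) (\<sigma> * b))"
    proof (cases "\<tau> * a = - (\<sigma> * b)")
      case True
      \<comment> \<open>One of the two copies of \<open>\<sigma> * b\<close> cancels
        \<open>\<tau> * a\<close>; the other one is
        \<open>- \<tau> * a = \<rho> * a\<close>.\<close>
      have "(\<Sum>u\<leftarrow>[\<tau> * a, 0 * a, \<sigma> * b, \<sigma> * b]. u ^ (2 * p + 1)) = (\<sigma> * b) ^ (2 * p + 1)" for p
        unfolding list.map True by simp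
      then have "?s = (\<lambda>p. \<sigma> * b)" by (simp only: odd_root_power)
      then show ?thesis using True neg by simp
    next
      case ne: False
      have s: "?s p = phi_add p (\<tau> * a) (phi_add p (\<sigma> * b) (\<sigma> * b))" for p
        unfolding phi_add_def[of p _ "phi_add p (\<sigma> * b) (\<sigma> * b)"] phi_add_power by simp
      have "(\<lambda>p. phi_add p (\<sigma> * b) (\<sigma> * b)) \<longlonglongrightarrow> \<sigma> * b"
        by (intro phi_add_tendsto_dominant) (auto intro: filterlim_ident)
      then have "(\<lambda>p. phi_add p (\<tau> * a) (phi_add p (\<sigma> * b) (\<sigma> * b))) \<longlonglongrightarrow> dominant (\<tau> * a) (\<sigma> * b)"
        using ne by (intro phi_add_tendsto) (auto intro: filterlim_ident)
      then show ?thesis using ne s by simp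
    qed
  qed
  then show ?thesis by (rule that)
qed

section \<open>The upper limit lies in the limit line\<close>

text \<open>Eliminating \<open>s\<close> by the normalisation expresses \<open>t\<close> as the
  quotient of the \<open>p\<close>-sum of the point and \<open>- b\<close> by the
  \<open>p\<close>-sum of \<open>a\<close> and \<open>- b\<close>. The numerator is bounded, and the
  denominator has a nonzero limit because \<open>a \<noteq> b\<close>.\<close>

lemma phi_line_coefficient_bound:
  fixes a b :: real
  assumes p: "filterlim p at_top sequentially" and "a \<noteq> b"
    and st: "\<And>k. phi_add (p k) (s k) (t k) = 1"
    and z: "(\<lambda>k. phi_add (p k) (t k * a) (s k * b)) \<longlonglongrightarrow> l"
  shows "Bseq t"
proof -
  define z where "z k = phi_add (p k) (t k * a) (s k * b)" for k
  define d where "d k = phi_add (p k) a (- b)" for k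
  have rel: "t k * d k = phi_add (p k) (z k) (- b)" for k
  proof -
    let ?N = "2 * p k + 1"
    have one: "s k ^ ?N = 1 - t k ^ ?N"
      using phi_add_power[of "p k" "s k" "t k"] st[of k] by simp
    have "z k ^ ?N = t k ^ ?N * a ^ ?N + (1 - t k ^ ?N) * b ^ ?N"
      unfolding z_def phi_add_power one[symmetric] by (simp only: power_mult_distrib)
    moreover have "(- b) ^ ?N = - (b ^ ?N)" by simp
    ultimately have "z k ^ ?N + (- b) ^ ?N = (t k * a) ^ ?N + (t k * (- b)) ^ ?N"
      by (simp only: power_mult_distrib) (simp add: algebra_simps del: power_Suc)
    then show ?thesis
      unfolding d_def phi_add_scale[symmetric] unfolding phi_add_def by simp
  qed
  have d: "d \<longlonglongrightarrow> dominant a (- b)"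
    unfolding d_def using \<open>a \<noteq> b\<close> by (intro phi_add_tendsto p tendsto_const) simp
  have nz: "dominant a (- b) \<noteq> 0" using \<open>a \<noteq> b\<close> by (auto simp: dominant_def)
  have "Bseq (\<lambda>k. inverse (d k))"
    using tendsto_inverse[OF d nz] by (intro convergent_imp_Bseq convergentI)
  then obtain D where D: "D > 0" "\<And>k. \<bar>inverse (d k)\<bar> \<le> D"
    by (auto elim!: BseqE)
  have "Bseq z" using z unfolding z_def by (intro convergent_imp_Bseq convergentI)
  then obtain Z where Z: "Z > 0" "\<And>k. \<bar>z k\<bar> \<le> Z"
    by (auto elim!: BseqE)
  have ev: "\<forall>\<^sub>F k in sequentially. d k \<noteq> 0"
    using tendsto_imp_eventually_ne[OF d nz] .
  have "\<forall>\<^sub>F k in sequentially. norm (t k) \<le> norm (2 * max Z \<bar>b\<bar> * D)"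
    using ev
  proof eventually_elim
    case (elim k)
    have "\<bar>t k\<bar> = \<bar>phi_add (p k) (z k) (- b)\<bar> * \<bar>inverse (d k)\<bar>"
      using elim rel[of k] by (simp flip: abs_mult add: field_simps)
    also have "\<dots> \<le> 2 * max \<bar>z k\<bar> \<bar>- b\<bar> * D"
      using D abs_phi_add_le_2[of "p k" "z k" "- b"] by (intro mult_mono) auto
    also have "\<dots> \<le> 2 * max Z \<bar>b\<bar> * D"
      using Z(2)[of k] D(1) by (intro mult_right_mono) auto
    finally show ?case using D(1) by simp
  qed
  then show ?thesis by (rule Bseq_eventually_mono) (rule Bfun_const)
qed

lemma Bseq_real_convergent_subseq:
  fixes f :: "nat \<Rightarrow> real"
  assumes "Bseq f"
  obtains l g where "strict_mono g" "(\<lambda>k. f (g k)) \<longlonglongrightarrow> l"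
  using assms bounded_imp_convergent_subsequence[of f]
  by (auto simp: Bseq_eq_bounded o_def)

lemma Bseq_phi_add:
  assumes "Bseq a" "Bseq b"
  shows "Bseq (\<lambda>k. phi_add (p k) (a k) (b k))"
proof -
  obtain A where A: "A > 0" "\<And>k. \<bar>a k\<bar> \<le> A" using assms(1) by (auto elim!: BseqE)
  obtain B where B: "B > 0" "\<And>k. \<bar>b k\<bar> \<le> B" using assms(2) by (auto elim!: BseqE)
  show ?thesis
  proof (rule BseqI')
    fix k
    have "2 * max \<bar>a k\<bar> \<bar>b k\<bar> \<le> 2 * max A B" using A(2)[of k] B(2)[of k] by (intro mult_left_mono max.mono) auto
    then show "norm (phi_add (p k) (a k) (b k)) \<le> 2 * max A B"
      using abs_phi_add_le_2[of "p k" "a k" "b k"] unfolding real_norm_def by linarith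
  qed
qed

lemma phi_line_limit_in_line_infty:
  fixes x y :: "real ^ 'n"
  assumes "x \<noteq> y" and p: "filterlim p at_top sequentially"
    and X: "\<And>k. X k \<in> phi_line (p k) x y" and l: "X \<longlonglongrightarrow> l"
  shows "l \<in> line_infty x y"
proof -
  have "\<forall>k. \<exists>s t. X k = phi_add_vec (p k) (t *\<^sub>R x) (s *\<^sub>R y) \<and> phi_add (p k) s t = 1"
    using X unfolding phi_line_def by blast
  then obtain s t where Xk: "\<And>k. X k = phi_add_vec (p k) (t k *\<^sub>R x) (s k *\<^sub>R y)"
    and one: "\<And>k. phi_add (p k) (s k) (t k) = 1" by metis
  have z: "(\<lambda>k. phi_add (p k) (t k * x $ i) (s k * y $ i)) \<longlonglongrightarrow> l $ i" for i
    using tendsto_vec_nth[OF l, of i] by (simp add: Xk phi_add_vec_def)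
  obtain j where j: "x $ j \<noteq> y $ j" using \<open>x \<noteq> y\<close> by (auto simp: vec_eq_iff)
  have Bt: "Bseq t"
    by (rule phi_line_coefficient_bound[OF p j one z])
  \<comment> \<open>The same bound with \<open>x\<close> and \<open>y\<close>, and their
    coefficients, exchanged.\<close>
  have Bs: "Bseq s"
    by (rule phi_line_coefficient_bound[OF p j[symmetric], where s = t])
      (use one z[of j] in \<open>auto simp: phi_add_commute\<close>)
  obtain \<tau> g1 where g1: "strict_mono g1" and t1: "(\<lambda>k. t (g1 k)) \<longlonglongrightarrow> \<tau>"
    using Bseq_real_convergent_subseq[OF Bt] .
  have "Bseq (\<lambda>k. s (g1 k))" by (rule Bseq_subseq[OF Bs])
  then obtain \<sigma> g2 where g2: "strict_mono g2" and s2: "(\<lambda>k. s (g1 (g2 k))) \<longlonglongrightarrow> \<sigma>"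
    by (rule Bseq_real_convergent_subseq)
  \<comment> \<open>The residue common to all cancelling coordinates. If \<sigma> is 0, the quotient
    is 0 by convention and \<open>q\<close> is just \<open>t\<close>; this is harmless, since a
    nonzero cancellation forces \<sigma> to be nonzero.\<close>
  define q where "q k = phi_add (p k) (t k) (- (\<tau> / \<sigma>) * s k)" for k
  have "Bseq (\<lambda>k. - (\<tau> / \<sigma>) * s k)"
    using Bfun_const Bs by (rule Bseq_mult)
  then have "Bseq q" unfolding q_def by (rule Bseq_phi_add[OF Bt])
  then have "Bseq (\<lambda>k. q (g1 (g2 k)))" by (rule Bseq_subseq)
  then obtain \<rho> g3 where g3: "strict_mono g3" and q3: "(\<lambda>k. q (g1 (g2 (g3 k)))) \<longlonglongrightarrow> \<rho>"
    by (rule Bseq_real_convergent_subseq)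
  define g where "g k = g1 (g2 (g3 k))" for k
  have g: "strict_mono g" using g1 g2 g3 by (simp add: g_def strict_mono_def)
  have pg: "filterlim (\<lambda>k. p (g k)) at_top sequentially"
    by (rule filterlim_compose[OF p filterlim_subseq[OF g]])
  have "(\<lambda>k. t (g1 (g2 (g3 k)))) \<longlonglongrightarrow> \<tau>"
    by (rule filterlim_compose[OF t1]) (intro filterlim_compose[OF filterlim_subseq[OF g2]] filterlim_subseq g3)
  then have t: "(\<lambda>k. t (g k)) \<longlonglongrightarrow> \<tau>" by (simp add: g_def)
  have s: "(\<lambda>k. s (g k)) \<longlonglongrightarrow> \<sigma>"
    unfolding g_def by (rule filterlim_compose[OF s2 filterlim_subseq[OF g3]])
  have q: "(\<lambda>k. q (g k)) \<longlonglongrightarrow> \<rho>" using q3 by (simp add: g_def)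
  have "\<bar>\<rho>\<bar> \<le> max \<bar>\<tau>\<bar> \<bar>- (\<tau> / \<sigma>) * \<sigma>\<bar>"
    by (rule phi_add_lim_abs_le[OF pg t _ q[unfolded q_def]]) (intro tendsto_intros s)
  also have "\<dots> \<le> \<bar>\<tau>\<bar>" by simp
  finally have "\<bar>\<rho>\<bar> \<le> \<bar>\<tau>\<bar>" .
  then obtain r w where rw: "\<And>a b. boxplus [\<tau> * a, r * a, \<sigma> * b, w * b] =
    (if \<tau> * a = - (\<sigma> * b) then \<rho> * a else dominant (\<tau> * a) (\<sigma> * b))"
    by (rule boxplus_with_residue[where \<sigma> = \<sigma>]) blast
  \<comment> \<open>Arbitrary \<open>a\<close>, \<open>b\<close> and \<open>c\<close> let one claim
    serve every coordinate and also the normalisation, where the \<open>p\<close>-sum is constantly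
    1.\<close>
  have key: "boxplus [\<tau> * a, r * a, \<sigma> * b, w * b] = c"
    if c: "(\<lambda>k. phi_add (p k) (t k * a) (s k * b)) \<longlonglongrightarrow> c" for a b c
  proof -
    have cg: "(\<lambda>k. phi_add (p (g k)) (t (g k) * a) (s (g k) * b)) \<longlonglongrightarrow> c"
      by (rule filterlim_compose[OF c filterlim_subseq[OF g]])
    show ?thesis
    proof (cases "\<tau> * a = - (\<sigma> * b) \<and> \<tau> * a \<noteq> 0")
      case True
      then have b: "b = - (\<tau> / \<sigma>) * a" by (auto simp: field_simps)
      have "phi_add (p k) (t k * a) (s k * b) = a * q k" for k
        unfolding b q_def phi_add_scale[symmetric] by (simp add: ac_simps)
      then have "(\<lambda>k. a * q (g k)) \<longlonglongrightarrow> c" using cg by simp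
      moreover have "(\<lambda>k. a * q (g k)) \<longlonglongrightarrow> a * \<rho>" by (intro tendsto_intros q)
      ultimately have "c = a * \<rho>" by (rule LIMSEQ_unique)
      then show ?thesis unfolding rw using True by simp
    next
      case False
      then have "(\<lambda>k. phi_add (p (g k)) (t (g k) * a) (s (g k) * b)) \<longlonglongrightarrow> dominant (\<tau> * a) (\<sigma> * b)"
        by (intro phi_add_tendsto pg tendsto_intros t s) auto
      then have "c = dominant (\<tau> * a) (\<sigma> * b)" using cg LIMSEQ_unique by blast
      \<comment> \<open>Here both products vanish, and
        \<open>\<bar>\<rho>\<bar> \<le> \<bar>\<tau>\<bar>\<close> makes \<open>\<rho> * a\<close>
        vanish as well.\<close>
      moreover have "\<rho> * a = dominant (\<tau> * a) (\<sigma> * b)" if "\<tau> * a = - (\<sigma> * b)"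
        using that False \<open>\<bar>\<rho>\<bar> \<le> \<bar>\<tau>\<bar>\<close> by (auto simp: dominant_def)
      ultimately show ?thesis unfolding rw by simp
    qed
  qed
  have "boxplus [\<tau> * 1, r * 1, \<sigma> * 1, w * 1] = 1"
    by (rule key) (use one in \<open>simp add: phi_add_commute\<close>)
  moreover have "l = boxplus_vec [\<tau> *\<^sub>R x, r *\<^sub>R x, \<sigma> *\<^sub>R y, w *\<^sub>R y]"
    using key[OF z] by (simp add: boxplus_vec_def vec_eq_iff)
  ultimately show ?thesis unfolding line_infty_def by auto
qed

section \<open>The limit line lies in the lower limit\<close>

lemma line_infty_subset_Li:
  fixes x y :: "real ^ 'n"
  shows "line_infty x y \<subseteq> PK_Li (\<lambda>p. phi_line p x y)"
proof
  fix l assume "l \<in> line_infty x y"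
  then obtain t r s w where l: "l = boxplus_vec [t *\<^sub>R x, r *\<^sub>R x, s *\<^sub>R y, w *\<^sub>R y]"
    and one: "boxplus [t, r, s, w] = 1" unfolding line_infty_def by blast
  define c where "c p = phi_add p (phi_add p t r) (phi_add p s w)" for p
  have list: "root (2 * p + 1) (\<Sum>u\<leftarrow>[a, b, d, e]. u ^ (2 * p + 1))
      = phi_add p (phi_add p a b) (phi_add p d e)" for p a b d e
    unfolding phi_add_def[of p "phi_add p a b"] phi_add_power by (simp add: add.assoc)
  have c: "c \<longlonglongrightarrow> 1"
    using boxplus_tendsto[of "[t, r, s, w]"] unfolding one list c_def .
  \<comment> \<open>The lower limit needs a point on the line for every \<open>p\<close>, but
    \<open>c p\<close> is known to be nonzero only eventually. The defaults 1 and 0 select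
    \<open>x\<close> for the other indices.\<close>
  define T where "T p = (if c p = 0 then 1 else phi_add p t r / c p)" for p
  define S where "S p = (if c p = 0 then 0 else phi_add p s w / c p)" for p
  define X where "X p = phi_add_vec p (T p *\<^sub>R x) (S p *\<^sub>R y)" for p
  have "phi_add p (S p) (T p) = 1" for p
  proof (cases "c p = 0")
    case True
    then show ?thesis by (simp add: S_def T_def phi_add_def)
  next
    case False
    then show ?thesis
      using phi_add_scale[of p "inverse (c p)" "phi_add p t r" "phi_add p s w"]
      by (simp add: S_def T_def phi_add_commute[of p "inverse (c p) * phi_add p s w"]
          divide_inverse_commute flip: c_def)
  qed
  then have "X p \<in> phi_line p x y" for p unfolding phi_line_def X_def by blast
  moreover have "X \<longlonglongrightarrow> l"
  proof (rule vec_tendstoI)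
    fix i
    let ?b = "\<lambda>p. phi_add p (phi_add p (t * x $ i) (r * x $ i)) (phi_add p (s * y $ i) (w * y $ i))"
    have "?b \<longlonglongrightarrow> l $ i"
      using boxplus_tendsto[of "[t * x $ i, r * x $ i, s * y $ i, w * y $ i]"]
      unfolding list by (simp add: l boxplus_vec_def)
    then have "(\<lambda>p. ?b p / c p) \<longlonglongrightarrow> l $ i"
      using tendsto_divide[OF _ c, of ?b "l $ i"] by simp
    moreover have "\<forall>\<^sub>F p in sequentially. ?b p / c p = X p $ i"
      using tendsto_imp_eventually_ne[OF c one_neq_zero]
    proof eventually_elim
      case (elim p)
      have "phi_add p (t * a) (r * a) = a * phi_add p t r" for t r a
        using phi_add_scale[of p a t r] by (simp add: mult.commute[of _ a])
      note this[of t "x $ i" r] this[of s "y $ i" w]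
      \<comment> \<open>With \<open>c p\<close> as a common factor, homogeneity turns the division
        by \<open>c p\<close> into the normalised coefficients \<open>T p\<close> and
        \<open>S p\<close>.\<close>
      then have "?b p = phi_add p (c p * (T p * x $ i)) (c p * (S p * y $ i))"
        using elim by (simp add: T_def S_def mult.commute)
      then show ?case
        unfolding phi_add_scale using elim by (simp add: X_def phi_add_vec_def)
    qed
    ultimately show "(\<lambda>p. X p $ i) \<longlonglongrightarrow> l $ i" by (rule Lim_transform_eventually)
  qed
  ultimately show "l \<in> PK_Li (\<lambda>p. phi_line p x y)" unfolding PK_Li_def by blast
qed

lemma PK_Li_subset_Ls: "PK_Li A \<subseteq> PK_Ls A"
proof
  fix l assume "l \<in> PK_Li A"
  then obtain X where "\<forall>p. X p \<in> A p" "X \<longlonglongrightarrow> l" unfolding PK_Li_def by blast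
  then have "strict_mono (id :: nat \<Rightarrow> nat) \<and> (\<forall>k. X k \<in> A (id k)) \<and> X \<longlonglongrightarrow> l"
    by (simp add: strict_mono_def)
  then show "l \<in> PK_Ls A" unfolding PK_Ls_def by blast
qed

theorem proposition4p1p4:
  fixes x y :: "real ^ 'n"
  assumes "x \<noteq> y"
  shows "PK_converges_to (\<lambda>p. phi_line p x y) (line_infty x y)"
proof -
  have "PK_Ls (\<lambda>p. phi_line p x y) \<subseteq> line_infty x y"
    using phi_line_limit_in_line_infty[OF assms filterlim_subseq] unfolding PK_Ls_def by blast
  then show ?thesis
    unfolding PK_converges_to_def
    using line_infty_subset_Li[of x y] PK_Li_subset_Ls[of "\<lambda>p. phi_line p x y"] by blast
qed

end
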